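(* For every real $d$ with $0\le d\le \tfrac12$, \[ \sum_{n=1,3,5,\ldots}\frac{\cos(2\pi n d)}{n^2}=\frac{\pi^2}{8}(1-4d), \] where the sum is over all positive odd integers $n$. *)

theory Defs
  imports "HOL-Analysis.Analysis"
begin

end

theory Submission
  imports Defs
begin

text \<open>
  Put \<open>x = 2 * pi * d\<close>, so that \<open>x\<close> ranges over \<open>[0, pi]\<close>. The claim is that the cosine series
  with coefficients \<open>1 / (2 * k + 1)\<^sup>2\<close> sums to a linear function there: it is the Fourier series
  of a triangle wave. Its termwise derivative is minus the sine series with coefficients
  \<open>1 / (2 * k + 1)\<close>, the series of a square wave. So it suffices to show that the sine series
  equals \<open>pi / 4\<close> on \<open>(0, pi)\<close>, with enough uniformity to differentiate the cosine series term
  by term; the constant of integration is fixed at \<open>x = pi / 2\<close>, where every cosine vanishes.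

  For the sine series, the derivative of a partial sum is a Dirichlet kernel,
  \<open>sin (2 * N * x) / (2 * sin x)\<close>. This does not tend to zero, but it oscillates so fast that its
  integral does: subtracting the explicit approximate antiderivative
  \<open>- cos (2 * N * x) / (4 * N * sin x)\<close>, itself of size \<open>1 / N\<close>, leaves a function whose
  derivative is of size \<open>1 / N\<close> (\<open>odd_sine_sum_oscillation\<close>). Hence the partial sums are
  asymptotically constant away from \<open>0\<close> and \<open>pi\<close>, and the constant is read off at \<open>pi / 2\<close>, where
  the series is the Leibniz series for \<open>pi / 4\<close> (\<open>odd_sine_series_uniform_limit\<close>).
  The endpoints \<open>0\<close> and \<open>pi\<close> follow by continuity, because the cosine series converges uniformly
  on the whole line.
\<close>

lemma sum_cos_odd_multiples:
  fixes x :: real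
  shows "(\<Sum>k<N. cos (real (2 * k + 1) * x)) * (2 * sin x) = sin (2 * real N * x)"
proof (induction N)
  case (Suc N)
  have "cos (real (2 * N + 1) * x) * (2 * sin x)
      = sin (real (2 * N + 1) * x + x) - sin (real (2 * N + 1) * x - x)"
    by (simp only: sin_add sin_diff)
  also have "\<dots> = sin (2 * real (Suc N) * x) - sin (2 * real N * x)"
    by (simp add: algebra_simps)
  finally show ?case
    using Suc.IH by (simp add: distrib_right)
qed simp

lemma sin_odd_multiple_half_pi: "sin (real (2 * k + 1) * (pi / 2)) = (- 1) ^ k"
proof -
  have "sin (real (2 * k + 1) * (pi / 2)) = sin (real k * pi + pi / 2)"
    by (simp add: algebra_simps)
  then show ?thesis
    by (simp add: sin_add cos_npi mult.commute)
qed

lemma cos_odd_multiple_half_pi: "cos (real (2 * k + 1) * (pi / 2)) = 0"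
proof -
  have "cos (real (2 * k + 1) * (pi / 2)) = cos (real k * pi + pi / 2)"
    by (simp add: algebra_simps)
  then show ?thesis
    by (simp add: cos_add sin_npi mult.commute)
qed

lemma sin_ge_sin_endpoint:
  fixes e x :: real
  assumes "0 < e" "e \<le> x" "x \<le> pi - e"
  shows "sin e \<le> sin x"
proof (cases "x \<le> pi / 2")
  case True
  then show ?thesis
    using assms by (intro sin_monotone_2pi_le) auto
next
  case False
  then have "sin e \<le> sin (pi - x)"
    using assms by (intro sin_monotone_2pi_le) auto
  then show ?thesis by simp
qed

text \<open>
  The two error sources are the correction term, at most \<open>1 / (4 * N * sin e)\<close> at \<open>x\<close> and at
  \<open>pi / 2\<close>, and the derivative of the corrected sum, at most \<open>1 / (4 * N * (sin e)\<^sup>2)\<close>, over a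
  distance of at most \<open>pi\<close>.
\<close>
lemma odd_sine_sum_oscillation:
  fixes e x :: real
  assumes e: "0 < e" "e \<le> pi / 2" and x: "x \<in> {e..pi - e}" and N: "N > 0"
  shows "\<bar>(\<Sum>k<N. sin (real (2 * k + 1) * x) / real (2 * k + 1))
          - (\<Sum>k<N. sin (real (2 * k + 1) * (pi / 2)) / real (2 * k + 1))\<bar>
         \<le> (pi + 2) / (4 * (sin e)\<^sup>2) / real N"
proof -
  define S where "S y = (\<Sum>k<N. sin (real (2 * k + 1) * y) / real (2 * k + 1))" for y :: real
  define C where "C y = cos (2 * real N * y) / (4 * real N * sin y)" for y :: real
  define D where "D y = - (cos (2 * real N * y) * cos y) / (4 * real N * (sin y)\<^sup>2)" for y :: real
  define s where "s = sin e"
  have s: "0 < s" "s \<le> 1"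
    using e sin_gt_zero[of e] by (auto simp: s_def)
  have s_le: "s \<le> sin y" if "y \<in> {e..pi - e}" for y
    using that e sin_ge_sin_endpoint by (simp add: s_def)
  have pos: "0 < sin y" if "y \<in> {e..pi - e}" for y
    using s_le[OF that] s by linarith

  have deriv: "((\<lambda>y. S y + C y) has_field_derivative D y) (at y within {e..pi - e})"
    if y: "y \<in> {e..pi - e}" for y
  proof -
    have S': "(S has_field_derivative (\<Sum>k<N. cos (real (2 * k + 1) * y))) (at y)"
      unfolding S_def by (auto intro!: derivative_eq_intros sum.cong simp del: of_nat_add of_nat_mult of_nat_Suc)
    have kernel: "(\<Sum>k<N. cos (real (2 * k + 1) * y)) = sin (2 * real N * y) / (2 * sin y)"
      using sum_cos_odd_multiples[where x = y and N = N] pos[OF y] by (simp add: field_simps)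
    have C': "(C has_field_derivative
        ((- sin (2 * real N * y) * (2 * real N)) * (4 * real N * sin y)
          - cos (2 * real N * y) * (4 * real N * cos y))
        / ((4 * real N * sin y) * (4 * real N * sin y))) (at y)"
      unfolding C_def using pos[OF y] N by (auto intro!: derivative_eq_intros)
    have "sin (2 * real N * y) / (2 * sin y)
        + ((- sin (2 * real N * y) * (2 * real N)) * (4 * real N * sin y)
          - cos (2 * real N * y) * (4 * real N * cos y))
        / ((4 * real N * sin y) * (4 * real N * sin y)) = D y"
      using pos[OF y] N by (simp add: D_def field_simps power2_eq_square)
    then show ?thesis
      using DERIV_add[OF S' C'] kernel by (metis has_field_derivative_at_within)
  qed

  have D_bound: "norm (D y) \<le> 1 / (4 * real N * s\<^sup>2)" if y: "y \<in> {e..pi - e}" for y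
  proof -
    have "\<bar>cos (2 * real N * y) * cos y\<bar> \<le> 1 * 1"
      unfolding abs_mult by (intro mult_mono) auto
    moreover have "4 * real N * s\<^sup>2 \<le> 4 * real N * (sin y)\<^sup>2"
      using s_le[OF y] s by (intro mult_left_mono power_mono) auto
    ultimately have "\<bar>cos (2 * real N * y) * cos y\<bar> / (4 * real N * (sin y)\<^sup>2)
        \<le> 1 / (4 * real N * s\<^sup>2)"
      using N s by (intro frac_le) auto
    then show ?thesis
      by (simp add: D_def abs_mult)
  qed

  have C_bound: "\<bar>C y\<bar> \<le> 1 / (4 * real N * s\<^sup>2)" if y: "y \<in> {e..pi - e}" for y
  proof -
    have "s\<^sup>2 \<le> s * 1"
      unfolding power2_eq_square using s by (intro mult_left_mono) auto
    then have "4 * real N * s\<^sup>2 \<le> 4 * real N * sin y"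
      using s_le[OF y] by (intro mult_left_mono) auto
    then have "\<bar>cos (2 * real N * y)\<bar> / (4 * real N * sin y) \<le> 1 / (4 * real N * s\<^sup>2)"
      using N s by (intro frac_le) auto
    then show ?thesis
      using pos[OF y] by (simp add: C_def abs_mult)
  qed

  have mid: "pi / 2 \<in> {e..pi - e}"
    using e by auto
  have "norm ((S x + C x) - (S (pi / 2) + C (pi / 2)))
      \<le> 1 / (4 * real N * s\<^sup>2) * norm (x - pi / 2)"
    by (rule field_differentiable_bound[OF _ deriv D_bound x mid]) auto
  also have "\<dots> \<le> 1 / (4 * real N * s\<^sup>2) * pi"
    using x e by (intro mult_left_mono) (auto simp: abs_if)
  finally have "\<bar>S x - S (pi / 2)\<bar> \<le> 1 / (4 * real N * s\<^sup>2) * pi + \<bar>C x\<bar> + \<bar>C (pi / 2)\<bar>"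
    by (simp add: abs_le_iff abs_if split: if_splits)
  also have "\<dots> \<le> 1 / (4 * real N * s\<^sup>2) * pi + 1 / (4 * real N * s\<^sup>2) + 1 / (4 * real N * s\<^sup>2)"
    using C_bound[OF x] C_bound[OF mid] by linarith
  also have "\<dots> = (pi + 2) / (4 * s\<^sup>2) / real N"
    using s N by (simp add: field_simps)
  finally show ?thesis
    by (simp add: S_def s_def)
qed

lemma odd_sine_series_uniform_limit:
  fixes e :: real
  assumes e: "0 < e" "e \<le> pi / 2"
  shows "uniform_limit {e..pi - e}
           (\<lambda>N x. \<Sum>k<N. sin (real (2 * k + 1) * x) / real (2 * k + 1)) (\<lambda>_. pi / 4) sequentially"
proof -
  define S where "S N x = (\<Sum>k<N. sin (real (2 * k + 1) * x) / real (2 * k + 1))"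
    for N and x :: real
  define K where "K = (pi + 2) / (4 * (sin e)\<^sup>2)"
  have oscillation: "uniform_limit {e..pi - e} (\<lambda>N x. S N x - S N (pi / 2)) (\<lambda>_. 0) sequentially"
  proof (rule uniform_limitI)
    fix r :: real
    assume r: "0 < r"
    have "(\<lambda>N. K / real N) \<longlonglongrightarrow> 0"
      by (rule lim_const_over_n)
    then have "eventually (\<lambda>N. K / real N < r) sequentially"
      using r by (rule order_tendstoD)
    then show "\<forall>\<^sub>F N in sequentially. \<forall>x\<in>{e..pi - e}. dist (S N x - S N (pi / 2)) 0 < r"
      using eventually_gt_at_top[of 0]
    proof eventually_elim
      case (elim N)
      then show ?case
        using odd_sine_sum_oscillation[OF e, of _ N] by (force simp: S_def K_def)
    qed
  qed
  have "summable (\<lambda>k. (- 1) ^ k * (1 / real (k * 2 + 1)))"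
    using summable_arctan_series[of 1] by simp
  then have "(\<lambda>k. (- 1) ^ k * 1 / real (k * 2 + 1)) sums (pi / 4)"
    unfolding pi_series by (intro summable_sums) simp
  then have "(\<lambda>N. S N (pi / 2)) \<longlonglongrightarrow> pi / 4"
    unfolding S_def sin_odd_multiple_half_pi sums_def by (simp add: mult.commute)
  then have "uniform_limit {e..pi - e} (\<lambda>N _. S N (pi / 2)) (\<lambda>_. pi / 4) sequentially"
    by (simp add: uniform_limit_iff tendsto_iff eventually_mono)
  from uniform_limit_add[OF oscillation this] show ?thesis
    by (simp add: S_def)
qed

lemma odd_cosine_series_interior:
  fixes x :: real
  assumes "0 < x" "x < pi"
  shows "(\<lambda>k. cos (real (2 * k + 1) * x) / (real (2 * k + 1))\<^sup>2) sums (pi / 4 * (pi / 2 - x))"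
proof -
  \<comment> \<open>A compact interval that contains both \<open>x\<close> and the base point \<open>pi / 2\<close> and avoids the zeros of
    \<open>sin\<close> at \<open>0\<close> and \<open>pi\<close>.\<close>
  define e where "e = min x (pi - x)"
  have e: "0 < e" "e \<le> pi / 2" and x: "x \<in> {e..pi - e}" and mid: "pi / 2 \<in> {e..pi - e}"
    using assms by (auto simp: e_def min_def)
  have term_deriv: "((\<lambda>y. cos (real (2 * k + 1) * y) / (real (2 * k + 1))\<^sup>2) has_field_derivative
      - (sin (real (2 * k + 1) * y) / real (2 * k + 1))) (at y within {e..pi - e})" for k y
    by (rule derivative_eq_intros refl | simp add: power2_eq_square del: of_nat_add of_nat_mult of_nat_Suc)+
  have lim: "uniform_limit {e..pi - e}
      (\<lambda>N y. \<Sum>k<N. - (sin (real (2 * k + 1) * y) / real (2 * k + 1))) (\<lambda>_. - (pi / 4)) sequentially"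
    unfolding sum_negf by (intro uniform_limit_uminus odd_sine_series_uniform_limit e)
  have vanish: "(\<lambda>k. cos (real (2 * k + 1) * (pi / 2)) / (real (2 * k + 1))\<^sup>2) = (\<lambda>_. 0)"
    by (simp only: cos_odd_multiple_half_pi) simp
  have "summable (\<lambda>k. cos (real (2 * k + 1) * (pi / 2)) / (real (2 * k + 1))\<^sup>2)"
    unfolding vanish by simp
  from has_field_derivative_series[OF _ term_deriv lim mid this]
  obtain g where g: "\<And>y. y \<in> {e..pi - e} \<Longrightarrow>
        (\<lambda>k. cos (real (2 * k + 1) * y) / (real (2 * k + 1))\<^sup>2) sums g y"
      "\<And>y. y \<in> {e..pi - e} \<Longrightarrow> (g has_field_derivative - (pi / 4)) (at y within {e..pi - e})"
    using convex_real_interval(5) by blast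
  have "((\<lambda>y. g y + pi / 4 * y) has_field_derivative 0) (at y within {e..pi - e})"
    if "y \<in> {e..pi - e}" for y
    by (rule derivative_eq_intros g(2)[OF that] refl | simp)+
  then obtain c where c: "\<And>y. y \<in> {e..pi - e} \<Longrightarrow> g y + pi / 4 * y = c"
    using has_field_derivative_zero_constant[of "{e..pi - e}" "\<lambda>y. g y + pi / 4 * y"]
      convex_real_interval(5) by blast
  have "g (pi / 2) = 0"
    using g(1)[OF mid] unfolding vanish by (simp add: sums_iff)
  then have "g x = pi / 4 * (pi / 2 - x)"
    using c[OF mid] c[OF x] by (simp add: algebra_simps)
  then show ?thesis
    using g(1)[OF x] by (simp only:)
qed

lemma summable_inverse_odd_squares: "summable (\<lambda>k. 1 / (real (2 * k + 1))\<^sup>2)"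
proof (rule summable_comparison_test')
  show "summable (\<lambda>k. 1 / (real k + 1)\<^sup>2)"
    using inverse_squares_sums by (auto simp: sums_iff add.commute)
  show "norm (1 / (real (2 * k + 1))\<^sup>2) \<le> 1 / (real k + 1)\<^sup>2" if "0 \<le> k" for k
    by (auto intro!: frac_le power_mono)
qed

lemma odd_cosine_term_bound:
  fixes x :: real
  shows "norm (cos (real (2 * k + 1) * x) / (real (2 * k + 1))\<^sup>2) \<le> 1 / (real (2 * k + 1))\<^sup>2"
  by (simp add: divide_right_mono)

theorem odd_cosine_series:
  fixes x :: real
  assumes "0 \<le> x" "x \<le> pi"
  shows "(\<lambda>k. cos (real (2 * k + 1) * x) / (real (2 * k + 1))\<^sup>2) sums (pi / 4 * (pi / 2 - x))"
proof -
  define F where "F y = (\<Sum>k. cos (real (2 * k + 1) * y) / (real (2 * k + 1))\<^sup>2)" for y :: real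
  have summable: "summable (\<lambda>k. cos (real (2 * k + 1) * y) / (real (2 * k + 1))\<^sup>2)" for y :: real
    using summable_inverse_odd_squares odd_cosine_term_bound by (rule summable_comparison_test'[where N = 0])
  have "uniform_limit UNIV (\<lambda>N y. \<Sum>k<N. cos (real (2 * k + 1) * y) / (real (2 * k + 1))\<^sup>2) F sequentially"
    unfolding F_def by (rule Weierstrass_m_test[OF odd_cosine_term_bound summable_inverse_odd_squares])
  then have "continuous_on UNIV F"
    by (rule uniform_limit_theorem[rotated]) (auto intro!: always_eventually continuous_intros)
  then have "continuous_on (closure {0<..<pi}) (\<lambda>y. F y - pi / 4 * (pi / 2 - y))"
    by (auto intro!: continuous_intros intro: continuous_on_subset)
  moreover have "F y - pi / 4 * (pi / 2 - y) = 0" if "y \<in> {0<..<pi}" for y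
    using odd_cosine_series_interior[of y] that by (simp add: F_def sums_iff)
  moreover have "x \<in> closure {0<..<pi}"
    using assms by (simp add: closure_greaterThanLessThan)
  ultimately have "F x - pi / 4 * (pi / 2 - x) = 0"
    by (rule continuous_constant_on_closure)
  then have "F x = pi / 4 * (pi / 2 - x)"
    by (simp only: right_minus_eq)
  then show ?thesis
    using summable_sums[OF summable, of x] by (simp only: F_def)
qed

theorem corollary3:
  fixes d :: real
  assumes "0 \<le> d" and "d \<le> 1 / 2"
  shows "((\<lambda>n::nat. cos (2 * pi * real n * d) / (real n)\<^sup>2) has_sum
            (pi\<^sup>2 / 8 * (1 - 4 * d))) {n. odd n}"
proof -
  define x where "x = 2 * pi * d"
  have x: "0 \<le> x" "x \<le> pi"
    using assms mult_left_le[of "2 * d" pi] by (simp_all add: x_def mult_ac)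
  let ?a = "\<lambda>k. cos (real (2 * k + 1) * x) / (real (2 * k + 1))\<^sup>2"
  have "summable (\<lambda>k. norm (?a k))"
    by (rule summable_comparison_test'[OF summable_inverse_odd_squares, where N = 0])
       (simp only: real_norm_def abs_idempotent odd_cosine_term_bound[unfolded real_norm_def])
  then have "(?a has_sum (pi / 4 * (pi / 2 - x))) UNIV"
    using odd_cosine_series[OF x] by (rule norm_summable_imp_has_sum)
  \<comment> \<open>Absolute convergence turns the ordered sum into an unordered one, which can be reindexed.\<close>
  also have "?a = (\<lambda>n. cos (2 * pi * real n * d) / (real n)\<^sup>2) \<circ> (\<lambda>k. 2 * k + 1)"
    by (simp add: fun_eq_iff x_def mult_ac)
  also have "pi / 4 * (pi / 2 - x) = pi\<^sup>2 / 8 * (1 - 4 * d)"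
    by (simp add: x_def field_simps power2_eq_square)
  finally have composed: "((\<lambda>n. cos (2 * pi * real n * d) / (real n)\<^sup>2) \<circ> (\<lambda>k. 2 * k + 1) has_sum
      (pi\<^sup>2 / 8 * (1 - 4 * d))) UNIV" .
  have "inj (\<lambda>k::nat. 2 * k + 1)"
    by (simp add: inj_on_def)
  from composed have "((\<lambda>n. cos (2 * pi * real n * d) / (real n)\<^sup>2) has_sum (pi\<^sup>2 / 8 * (1 - 4 * d)))
      (range (\<lambda>k::nat. 2 * k + 1))"
    unfolding has_sum_reindex[OF \<open>inj (\<lambda>k::nat. 2 * k + 1)\<close>] .
  also have "range (\<lambda>k::nat. 2 * k + 1) = {n. odd n}"
    unfolding image_def set_eq_iff by (auto elim!: oddE)
  finally show ?thesis .
qed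

end
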